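(* For an arbitrary convex domain $G\subsetneq\mathbb{R}^n$, the function $w_G$ is a quasi-metric on $G$ with a constant less than or equal to $\sqrt{2}$, i.e. it satisfies positivity and symmetry, and there is a constant $c\le\sqrt{2}$ with $w_G(x,y)\le c\,(w_G(x,z)+w_G(z,y))$ for all $x,y,z\in G$. Moreover, the number $\sqrt{2}$ here is sharp: no constant smaller than $\sqrt{2}$ can be used in its place simultaneously for all dimensions $n$ and all convex domains $G\subsetneq\mathbb{R}^n$.
   Context: A domain is a non-empty open connected set. For a convex domain $G\subsetneq\mathbb{R}^n$ and $x\in G$, let $d_G(x)=\inf\{|x-z| : z\in\partial G\}$, $S^{n-1}(x,r)=\{y\in\mathbb{R}^n : |x-y|=r\}$, and let $\widetilde{X}$ be the non-empty set $$\widetilde{X}=\{\widetilde{x}\in S^{n-1}(x,2d_G(x)) : (x+\widetilde{x})/2\in\partial G\};$$ for $y\in G$ the set $\widetilde{Y}$ is defined in the same way from $y$. The function $w_G:G\times G\to[0,1]$ is $$w_G(x,y)=\frac{|x-y|}{\min\{\inf_{\widetilde{y}\in\widetilde{Y}}|x-\widetilde{y}|,\ \inf_{\widetilde{x}\in\widetilde{X}}|y-\widetilde{x}|\}}.$$ Positivity of a function $d:G\times G\to[0,\infty)$ means $d(x,y)\ge 0$, with $d(x,y)=0$ if and only if $x=y$; symmetry means $d(x,y)=d(y,x)$. A quasi-metric with constant $c$ is a function satisfying positivity, symmetry, and $d(x,y)\le c(d(x,z)+d(z,y))$ for all $x,y,z$, with $c$ independent of $x,y,z$. *)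

theory Defs
  imports "HOL-Analysis.Analysis"
begin

text \<open>
  The sharpness claim quantifies over the dimension, so the points of $R^n$ are the elements of
  the topological space \<^const>\<open>Euclidean_space\<close> \<open>n\<close>, i.e. sequences \<open>x :: nat \<Rightarrow> real\<close> with
  \<open>x i = 0\<close> for all \<open>i \<ge> n\<close>. Distances are Euclidean: the library's \<^const>\<open>dist\<close> on
  \<open>nat \<Rightarrow> real\<close> is a different metric and is not used.
\<close>

definition eucl_dist :: "nat \<Rightarrow> (nat \<Rightarrow> real) \<Rightarrow> (nat \<Rightarrow> real) \<Rightarrow> real" where
  "eucl_dist n x y = L2_set (\<lambda>i. x i - y i) {..<n}"

definition eucl_sphere :: "nat \<Rightarrow> (nat \<Rightarrow> real) \<Rightarrow> real \<Rightarrow> (nat \<Rightarrow> real) set" where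
  "eucl_sphere n x r = {y \<in> topspace (Euclidean_space n). eucl_dist n x y = r}"

definition seq_convex :: "(nat \<Rightarrow> real) set \<Rightarrow> bool" where
  "seq_convex G \<longleftrightarrow>
     (\<forall>x\<in>G. \<forall>y\<in>G. \<forall>u\<in>{0..1}. (\<lambda>i. (1 - u) * x i + u * y i) \<in> G)"

definition domain_in :: "nat \<Rightarrow> (nat \<Rightarrow> real) set \<Rightarrow> bool" where
  "domain_in n G \<longleftrightarrow>
     G \<noteq> {} \<and> openin (Euclidean_space n) G \<and> connectedin (Euclidean_space n) G"

definition proper_convex_domain :: "nat \<Rightarrow> (nat \<Rightarrow> real) set \<Rightarrow> bool" where
  "proper_convex_domain n G \<longleftrightarrow>
     domain_in n G \<and> seq_convex G \<and> G \<subset> topspace (Euclidean_space n)"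

abbreviation bdry :: "nat \<Rightarrow> (nat \<Rightarrow> real) set \<Rightarrow> (nat \<Rightarrow> real) set" where
  "bdry n G \<equiv> Euclidean_space n frontier_of G"

definition bdry_dist :: "nat \<Rightarrow> (nat \<Rightarrow> real) set \<Rightarrow> (nat \<Rightarrow> real) \<Rightarrow> real" where
  "bdry_dist n G x = (INF z\<in>bdry n G. eucl_dist n x z)"

text \<open>The set written $\widetilde{X}$ for the point $x$.\<close>

definition tilde_set :: "nat \<Rightarrow> (nat \<Rightarrow> real) set \<Rightarrow> (nat \<Rightarrow> real) \<Rightarrow> (nat \<Rightarrow> real) set" where
  "tilde_set n G x =
     {x' \<in> eucl_sphere n x (2 * bdry_dist n G x). (\<lambda>i. (x i + x' i) / 2) \<in> bdry n G}"

definition w_fun ::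
  "nat \<Rightarrow> (nat \<Rightarrow> real) set \<Rightarrow> (nat \<Rightarrow> real) \<Rightarrow> (nat \<Rightarrow> real) \<Rightarrow> real" where
  "w_fun n G x y =
     eucl_dist n x y /
       min (INF y'\<in>tilde_set n G y. eucl_dist n x y')
           (INF x'\<in>tilde_set n G x. eucl_dist n y x')"

definition quasi_metric_on :: "'a set \<Rightarrow> ('a \<Rightarrow> 'a \<Rightarrow> real) \<Rightarrow> real \<Rightarrow> bool" where
  "quasi_metric_on G d c \<longleftrightarrow>
     (\<forall>x\<in>G. \<forall>y\<in>G. 0 \<le> d x y \<and> (d x y = 0 \<longleftrightarrow> x = y)) \<and>
     (\<forall>x\<in>G. \<forall>y\<in>G. d x y = d y x) \<and>
     (\<forall>x\<in>G. \<forall>y\<in>G. \<forall>z\<in>G. d x y \<le> c * (d x z + d z y))"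

end

theory Submission
  imports Defs
begin

text \<open>
  For a fixed point \<open>v\<close>, the quotient \<open>|x - y| / (|x - v| + |v - y|)\<close> is a metric by Ptolemy's
  inequality. Taking the supremum over \<open>v\<close> outside \<open>G\<close> gives the triangular ratio metric
  \<open>s\<close>, and \<open>w \<le> s \<le> sqrt 2 * w\<close> yields the quasi-metric constant \<open>sqrt 2\<close>. The first estimate holds because
  the perpendicular bisector of a segment \<open>[y, y']\<close> with \<open>y'\<close> in the tilde set of \<open>y\<close> supports \<open>G\<close>.
  For the second one, convexity gives
  \<open>(|x - v| + |v - y|)\<^sup>2 \<ge> |x - y|\<^sup>2 + 4 a b\<close> with \<open>a \<le> b\<close> the boundary distances of \<open>x\<close> and
  \<open>y\<close>, while the denominator of \<open>w\<close> is at most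
  \<open>|x - y| + 2 a \<le> sqrt 2 * sqrt (|x - y|\<^sup>2 + 4 a\<^sup>2)\<close>.

  The constant is sharp because \<open>w\<close> is discontinuous: on the half-strip \<open>|s| < 2, t < 1\<close>, the
  point \<open>(1, 0)\<close> has two nearest boundary points, and \<open>(1 + \<epsilon>, 0)\<close> only one. Against
  \<open>(-1 - \<epsilon>, 0)\<close> the value of \<open>w\<close> is about \<open>1 / sqrt 2\<close> for the former and \<open>1 / 2\<close> for the latter.
\<close>

section \<open>Euclidean distance and affine combinations of points\<close>

abbreviation lerp :: "('a \<Rightarrow> real) \<Rightarrow> ('a \<Rightarrow> real) \<Rightarrow> real \<Rightarrow> 'a \<Rightarrow> real" where
  "lerp x y u \<equiv> \<lambda>i. (1 - u) * x i + u * y i"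

lemma eucl_dist_nonneg [simp]: "0 \<le> eucl_dist n x y"
  by (simp add: eucl_dist_def)

lemma eucl_dist_self [simp]: "eucl_dist n x x = 0"
  by (simp add: eucl_dist_def L2_set_def)

lemma eucl_dist_commute: "eucl_dist n x y = eucl_dist n y x"
  by (simp add: eucl_dist_def L2_set_def power2_commute)

lemma eucl_dist_sq: "(eucl_dist n x y)\<^sup>2 = (\<Sum>i<n. (x i - y i)\<^sup>2)"
  by (simp add: eucl_dist_def L2_set_def sum_nonneg)

lemma eucl_dist_triangle: "eucl_dist n x y \<le> eucl_dist n x z + eucl_dist n z y"
  using L2_set_triangle_ineq[of "\<lambda>i. x i - z i" "\<lambda>i. z i - y i" "{..<n}"]
  by (simp add: eucl_dist_def)

lemma eucl_dist_eq_0: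
  assumes "x \<in> topspace (Euclidean_space n)" "y \<in> topspace (Euclidean_space n)"
  shows "eucl_dist n x y = 0 \<longleftrightarrow> x = y"
proof -
  have "x = y" if "\<forall>i<n. x i = y i"
  proof
    show "x i = y i" for i
      using assms that by (cases "i < n") (auto simp: topspace_Euclidean_space)
  qed
  then show ?thesis
    by (auto simp: eucl_dist_def L2_set_eq_0_iff)
qed

text \<open>Stewart's theorem. It comes from a polynomial identity in each coordinate, so
  \<open>t\<close> may be any real, including the values above 1 that extend a segment beyond its
  endpoint.\<close>

lemma eucl_dist_lerp_sq:
  "(eucl_dist n z (lerp x y t))\<^sup>2 =
     (1 - t) * (eucl_dist n z x)\<^sup>2 + t * (eucl_dist n z y)\<^sup>2 - t * (1 - t) * (eucl_dist n x y)\<^sup>2"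
proof -
  have "(z i - lerp x y t i)\<^sup>2 =
     (1 - t) * (z i - x i)\<^sup>2 + t * (z i - y i)\<^sup>2 - t * (1 - t) * (x i - y i)\<^sup>2" for i
    by algebra
  then show ?thesis
    by (simp add: eucl_dist_sq sum.distrib sum_subtractf sum_distrib_left)
qed

lemma eucl_dist_scaled:
  assumes "\<And>i. i < n \<Longrightarrow> a i - b i = k * (x i - y i)"
  shows "eucl_dist n a b = \<bar>k\<bar> * eucl_dist n x y"
proof (rule power2_eq_imp_eq)
  show "(eucl_dist n a b)\<^sup>2 = (\<bar>k\<bar> * eucl_dist n x y)\<^sup>2"
    by (simp add: eucl_dist_sq power_mult_distrib assms sum_distrib_left)
qed auto

lemma eucl_dist_lerp_left: "eucl_dist n x (lerp x y u) = \<bar>u\<bar> * eucl_dist n x y"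
  by (rule eucl_dist_scaled) (simp add: algebra_simps)

lemma eucl_dist_lerp_right: "eucl_dist n (lerp x y u) y = \<bar>1 - u\<bar> * eucl_dist n x y"
  by (rule eucl_dist_scaled) (simp add: algebra_simps)

lemma coord_le_eucl_dist: "i < n \<Longrightarrow> \<bar>x i - y i\<bar> \<le> eucl_dist n x y"
  unfolding eucl_dist_def L2_set_def
  by (intro real_le_rsqrt) (auto intro!: member_le_sum)

section \<open>Topology of \<open>Euclidean_space n\<close>: compact balls and boundary
  crossings\<close>

lemma lerp_in_Euclidean_space:
  assumes "x \<in> topspace (Euclidean_space n)" "y \<in> topspace (Euclidean_space n)"
  shows "lerp x y u \<in> topspace (Euclidean_space n)"
  using assms by (simp add: topspace_Euclidean_space)

text \<open>Serves to transfer type-class results on open and connected sets of functions to the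
  abstract topology.\<close>

lemma Euclidean_space_eq_top_of_set:
  "Euclidean_space n = top_of_set (topspace (Euclidean_space n))"
  by (simp add: Euclidean_space_def euclidean_product_topology)

lemma openin_Euclidean_space_Int_open:
  "open U \<Longrightarrow> openin (Euclidean_space n) (topspace (Euclidean_space n) \<inter> U)"
  by (subst Euclidean_space_eq_top_of_set) (rule openin_open_Int)

lemma continuous_on_eucl_dist [continuous_intros]: "continuous_on S (eucl_dist n x)"
  unfolding eucl_dist_def L2_set_def
  by (intro continuous_intros continuous_on_subset[OF continuous_on_product_coordinates]) auto

lemma compact_box: "compact {y :: nat \<Rightarrow> real. \<forall>i. a i \<le> y i \<and> y i \<le> b i}"
proof -
  have "{y. \<forall>i. a i \<le> y i \<and> y i \<le> b i} = (\<Pi>\<^sub>E i\<in>UNIV. {a i..b i})"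
    by (auto simp: PiE_def)
  moreover have "compactin (powertop_real UNIV) (\<Pi>\<^sub>E i\<in>UNIV. {a i..b i})"
    by (subst compactin_PiE) auto
  ultimately show ?thesis
    by (simp add: euclidean_product_topology)
qed

text \<open>The ball is closed and sits inside a product of intervals, which is compact by
  Tychonoff. The bound \<open>\<bar>r\<bar>\<close> keeps the intervals non-empty for every
  \<open>r\<close>, also at the coordinates from \<open>n\<close> on, where both points are
  0.\<close>

lemma compact_cball_Euclidean_space:
  assumes "x \<in> topspace (Euclidean_space n)"
  shows "compact {y \<in> topspace (Euclidean_space n). eucl_dist n x y \<le> r}" (is "compact ?B")
proof -
  have "closed (topspace (Euclidean_space n))"
    using closedin_Euclidean_space_iff[of n "topspace (Euclidean_space n)"] by blast
  moreover have "closed {y. eucl_dist n x y \<le> r}"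
    by (intro closed_Collect_le continuous_intros)
  ultimately have "closed ?B"
    by (simp add: Collect_conj_eq closed_Int)
  moreover have "?B \<subseteq> {y. \<forall>i. x i - \<bar>r\<bar> \<le> y i \<and> y i \<le> x i + \<bar>r\<bar>}"
  proof clarify
    fix y i assume y: "y \<in> topspace (Euclidean_space n)" "eucl_dist n x y \<le> r"
    have "\<bar>x i - y i\<bar> \<le> \<bar>r\<bar>"
    proof (cases "i < n")
      case True
      then show ?thesis
        using coord_le_eucl_dist[of i n x y] y by linarith
    next
      case False
      then show ?thesis
        using y assms by (simp add: topspace_Euclidean_space)
    qed
    then show "x i - \<bar>r\<bar> \<le> y i \<and> y i \<le> x i + \<bar>r\<bar>"
      by linarith
  qed
  then have "{y. \<forall>i. x i - \<bar>r\<bar> \<le> y i \<and> y i \<le> x i + \<bar>r\<bar>} \<inter> ?B = ?B"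
    by (rule Int_absorb1)
  ultimately show ?thesis
    using compact_Int_closed[OF compact_box, of ?B "\<lambda>i. x i - \<bar>r\<bar>" "\<lambda>i. x i + \<bar>r\<bar>"] by simp
qed

lemma connected_lerp: "connected ((\<lambda>u. lerp x y u) ` {0..1})"
  by (intro connected_continuous_image continuous_intros) auto

lemma segment_meets_bdry:
  assumes "x \<in> topspace (Euclidean_space n)" "y \<in> topspace (Euclidean_space n)"
    and "x \<in> G" "y \<notin> G"
  obtains u where "0 \<le> u" "u \<le> 1" "lerp x y u \<in> bdry n G"
proof -
  let ?S = "(\<lambda>u. lerp x y u) ` {0..1}"
  have "connectedin (Euclidean_space n) ?S"
    using assms connected_lerp[of x y] lerp_in_Euclidean_space
    by (subst Euclidean_space_eq_top_of_set) (auto simp: connectedin_subtopology)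
  moreover have "x \<in> ?S \<inter> G"
    using assms by (auto intro!: image_eqI[of _ _ 0])
  moreover have "y \<in> ?S - G"
    using assms by (auto intro!: image_eqI[of _ _ 1])
  ultimately have "?S \<inter> bdry n G \<noteq> {}"
    by (intro connectedin_Int_frontier_of) auto
  then show ?thesis
    using that by auto
qed

lemma bdd_below_eucl_dist: "bdd_below (eucl_dist n x ` S)"
  by (rule bdd_belowI[of _ 0]) auto

lemma bdry_dist_le: "z \<in> bdry n G \<Longrightarrow> bdry_dist n G x \<le> eucl_dist n x z"
  unfolding bdry_dist_def by (rule cINF_lower[OF bdd_below_eucl_dist])

section \<open>Ptolemy's inequality and the ratio metric of a fixed point\<close>

lemma ptolemy_eucl_dist:
  assumes "0 < eucl_dist n x v" "0 < eucl_dist n y v" "0 < eucl_dist n z v"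
  shows "eucl_dist n x y * eucl_dist n z v \<le>
     eucl_dist n x z * eucl_dist n y v + eucl_dist n z y * eucl_dist n x v"
proof -
  \<comment> \<open>\<open>I\<close> is inversion in the unit sphere about \<open>v\<close>, with
    \<open>v\<close> translated to the origin. It divides the distance of \<open>a\<close> and
    \<open>b\<close> by the product of their distances to \<open>v\<close>, so the triangle
    inequality for the images is Ptolemy's inequality.\<close>
  define I where "I a = (\<lambda>i. (a i - v i) / (eucl_dist n a v)\<^sup>2)" for a
  have I: "eucl_dist n (I a) (I b) = eucl_dist n a b / (eucl_dist n a v * eucl_dist n b v)"
    if "0 < eucl_dist n a v" "0 < eucl_dist n b v" for a b
  proof (rule power2_eq_imp_eq)
    let ?A = "eucl_dist n a v" and ?B = "eucl_dist n b v"
    define p q where "p = 1 / ?A\<^sup>2" and "q = 1 / ?B\<^sup>2"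
    \<comment> \<open>The mixed terms \<open>(a i - v i) * (b i - v i)\<close> cancel in this
      difference, so only squared distances to \<open>v\<close> are left after summation.\<close>
    have "(I a i - I b i)\<^sup>2 - (a i - b i)\<^sup>2 * (p * q) =
        (a i - v i)\<^sup>2 * (p * (p - q)) + (b i - v i)\<^sup>2 * (q * (q - p))" for i
    proof -
      have "I a i = (a i - v i) * p" "I b i = (b i - v i) * q" "a i - b i = (a i - v i) - (b i - v i)"
        by (simp_all add: I_def p_def q_def)
      then show ?thesis
        by (simp only: power2_eq_square) (simp add: algebra_simps)
    qed
    then have "(\<Sum>i<n. (I a i - I b i)\<^sup>2) - (\<Sum>i<n. (a i - b i)\<^sup>2) * (p * q) =
        (\<Sum>i<n. (a i - v i)\<^sup>2) * (p * (p - q)) + (\<Sum>i<n. (b i - v i)\<^sup>2) * (q * (q - p))"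
      by (simp add: sum_distrib_right flip: sum_subtractf sum.distrib)
    also have "\<dots> = ?A\<^sup>2 * p * (p - q) + ?B\<^sup>2 * q * (q - p)"
      by (simp add: eucl_dist_sq)
    also have "\<dots> = 0"
      using that by (simp add: p_def q_def)
    finally show "(eucl_dist n (I a) (I b))\<^sup>2 = (eucl_dist n a b / (?A * ?B))\<^sup>2"
      by (simp add: p_def q_def power_divide power_mult_distrib flip: eucl_dist_sq)
  qed (use that in auto)
  have "eucl_dist n (I x) (I y) \<le> eucl_dist n (I x) (I z) + eucl_dist n (I z) (I y)"
    by (rule eucl_dist_triangle)
  then show ?thesis
    using assms by (simp add: I field_simps)
qed

text \<open>\<open>A\<close>, \<open>B\<close>, \<open>C\<close> stand for the distances of
  \<open>x\<close>, \<open>y\<close>, \<open>z\<close> to \<open>v\<close>. If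
  \<open>C \<le> A\<close>, both denominators on the right are at most \<open>A + B\<close> and the
  triangle inequality suffices. Otherwise \<open>A\<close> times the triangle inequality is added to
  Ptolemy's, and \<open>(B - A) * (C - A) \<ge> 0\<close> adjusts the coefficient of
  \<open>\<beta>\<close>.\<close>

lemma ratio_triangle_aux:
  fixes A B C \<alpha> \<beta> \<gamma> :: real
  assumes pos: "0 < A" "0 < B" "0 < C" "0 \<le> \<alpha>" "0 \<le> \<beta>" and AB: "A \<le> B"
    and tri: "\<gamma> \<le> \<alpha> + \<beta>" and pto: "\<gamma> * C \<le> \<alpha> * B + \<beta> * A"
  shows "\<gamma> / (A + B) \<le> \<alpha> / (A + C) + \<beta> / (C + B)"
proof (cases "C \<le> A")
  case True
  have "\<gamma> / (A + B) \<le> \<alpha> / (A + B) + \<beta> / (A + B)"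
    using tri pos by (simp add: divide_right_mono flip: add_divide_distrib)
  also have "\<dots> \<le> \<alpha> / (A + C) + \<beta> / (C + B)"
    using pos True AB by (intro add_mono divide_left_mono) auto
  finally show ?thesis .
next
  case False
  have "\<gamma> * C * (A + C) = A * C * \<gamma> + C * (\<gamma> * C)"
    by (simp add: algebra_simps)
  also have "\<dots> \<le> A * C * (\<alpha> + \<beta>) + C * (\<alpha> * B + \<beta> * A)"
    using pos tri pto by (intro add_mono mult_left_mono) auto
  finally have "C * (\<gamma> * (A + C)) \<le> C * (\<alpha> * (A + B) + \<beta> * (2 * A))"
    by (simp add: algebra_simps)
  then have *: "\<gamma> * (A + C) \<le> \<alpha> * (A + B) + \<beta> * (2 * A)"
    using pos by simp
  have "0 \<le> (B - A) * (C - A)"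
    using AB False by simp
  then have "2 * A * (C + B) \<le> (A + B) * (A + C)"
    by (simp add: algebra_simps)
  then have "2 * A \<le> (A + B) * (A + C) / (C + B)"
    using pos by (simp add: field_simps)
  then have "\<gamma> * (A + C) \<le> \<alpha> * (A + B) + \<beta> * ((A + B) * (A + C) / (C + B))"
    using * pos by (smt (verit) mult_left_mono)
  also have "\<dots> = (\<alpha> / (A + C) + \<beta> / (C + B)) * (A + B) * (A + C)"
    using pos by (simp add: divide_simps) (simp add: algebra_simps)
  finally show ?thesis
    using pos by (simp add: pos_divide_le_eq)
qed

lemma ratio_triangle:
  assumes "0 < eucl_dist n x v" "0 < eucl_dist n y v" "0 < eucl_dist n z v"
  shows "eucl_dist n x y / (eucl_dist n x v + eucl_dist n v y) \<le>
     eucl_dist n x z / (eucl_dist n x v + eucl_dist n v z) +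
     eucl_dist n z y / (eucl_dist n z v + eucl_dist n v y)"
proof (cases "eucl_dist n x v \<le> eucl_dist n y v")
  case True
  then show ?thesis
    using ratio_triangle_aux[OF assms eucl_dist_nonneg eucl_dist_nonneg True
        eucl_dist_triangle ptolemy_eucl_dist[OF assms]]
    by (simp add: eucl_dist_commute)
next
  case False
  then have le: "eucl_dist n y v \<le> eucl_dist n x v"
    by simp
  have perm: "0 < eucl_dist n y v" "0 < eucl_dist n x v" "0 < eucl_dist n z v"
    using assms by auto
  show ?thesis
    using ratio_triangle_aux[OF perm eucl_dist_nonneg eucl_dist_nonneg le
        eucl_dist_triangle ptolemy_eucl_dist[OF perm]]
    by (simp add: eucl_dist_commute add.commute)
qed


section \<open>The denominator of \<open>w_fun\<close> and the tilde sets\<close>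

definition w_denom :: "nat \<Rightarrow> (nat \<Rightarrow> real) set \<Rightarrow> (nat \<Rightarrow> real) \<Rightarrow> (nat \<Rightarrow> real) \<Rightarrow> real" where
  "w_denom n G x y =
     min (INF y'\<in>tilde_set n G y. eucl_dist n x y') (INF x'\<in>tilde_set n G x. eucl_dist n y x')"

lemma w_fun_eq: "w_fun n G x y = eucl_dist n x y / w_denom n G x y"
  by (simp add: w_fun_def w_denom_def)

lemma w_denom_commute: "w_denom n G x y = w_denom n G y x"
  by (simp add: w_denom_def min.commute)

lemma w_denom_le: "y' \<in> tilde_set n G y \<Longrightarrow> w_denom n G x y \<le> eucl_dist n x y'"
  unfolding w_denom_def
  by (intro min.coboundedI1 cINF_lower[OF bdd_below_eucl_dist])

lemma tilde_setD:
  assumes "x' \<in> tilde_set n G x"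
  shows "x' \<in> topspace (Euclidean_space n)" "eucl_dist n x x' = 2 * bdry_dist n G x"
    "lerp x x' (1/2) \<in> bdry n G"
proof -
  have "(\<lambda>i. (x i + x' i) / 2) = lerp x x' (1/2)"
    by (simp add: field_simps)
  then show "x' \<in> topspace (Euclidean_space n)" "eucl_dist n x x' = 2 * bdry_dist n G x"
    "lerp x x' (1/2) \<in> bdry n G"
    using assms by (simp_all add: tilde_set_def eucl_sphere_def)
qed

lemma exists_small_factor:
  fixes e K :: real
  assumes "0 < e" "0 \<le> K"
  obtains \<delta> where "0 < \<delta>" "\<delta> \<le> 1" "\<delta> * K < e"
proof
  show "e / (e + K) * K < e"
    using assms by (simp add: field_simps add_pos_nonneg)
qed (use assms in auto)

section \<open>Boundary distance in a convex domain\<close>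

locale convex_domain =
  fixes n :: nat and G :: "(nat \<Rightarrow> real) set"
  assumes proper_convex_domain: "proper_convex_domain n G"
begin

lemma in_space: "x \<in> G \<Longrightarrow> x \<in> topspace (Euclidean_space n)"
  using proper_convex_domain by (auto simp: proper_convex_domain_def)

lemma lerp_in: "x \<in> G \<Longrightarrow> y \<in> G \<Longrightarrow> 0 \<le> u \<Longrightarrow> u \<le> 1 \<Longrightarrow> lerp x y u \<in> G"
  using proper_convex_domain by (auto simp: proper_convex_domain_def seq_convex_def)

lemma bdry_notin: "z \<in> bdry n G \<Longrightarrow> z \<notin> G"
  using proper_convex_domain
  by (auto simp: proper_convex_domain_def domain_in_def frontier_of_openin)

lemma bdry_in_space: "z \<in> bdry n G \<Longrightarrow> z \<in> topspace (Euclidean_space n)"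
  using frontier_of_subset_topspace[of "Euclidean_space n" G] by blast

text \<open>Only boundary points no farther from \<open>x\<close> than some boundary point
  \<open>z\<close> matter, and these form a compact set. Such a \<open>z\<close> exists because
  \<open>G\<close> is a proper subset.\<close>

lemma nearest_bdry_point:
  assumes "x \<in> G"
  obtains m where "m \<in> bdry n G" "eucl_dist n x m = bdry_dist n G x"
proof -
  obtain e where "e \<in> topspace (Euclidean_space n)" "e \<notin> G"
    using proper_convex_domain by (auto simp: proper_convex_domain_def)
  then obtain z where z: "z \<in> bdry n G"
    using segment_meets_bdry assms in_space by metis
  define K where
    "K = {y \<in> topspace (Euclidean_space n). eucl_dist n x y \<le> eucl_dist n x z} \<inter> bdry n G"
  have "closed (bdry n G)"
    using closedin_Euclidean_imp_closed closedin_frontier_of by blast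
  then have "compact K"
    unfolding K_def by (intro compact_Int_closed compact_cball_Euclidean_space in_space assms)
  moreover have "z \<in> K"
    using z bdry_in_space by (simp add: K_def)
  ultimately obtain m where m: "m \<in> K" "\<And>y. y \<in> K \<Longrightarrow> eucl_dist n x m \<le> eucl_dist n x y"
    using continuous_attains_inf[of K "eucl_dist n x"] continuous_on_eucl_dist by blast
  have le: "eucl_dist n x m \<le> eucl_dist n x y" if "y \<in> bdry n G" for y
  proof (cases "y \<in> K")
    case False
    then have "eucl_dist n x z < eucl_dist n x y"
      using that bdry_in_space by (auto simp: K_def)
    then show ?thesis
      using m \<open>z \<in> K\<close> by force
  qed (use m in auto)
  have "m \<in> bdry n G"
    using m by (simp add: K_def)
  moreover have "bdry_dist n G x = eucl_dist n x m"
  proof (rule antisym)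
    show "bdry_dist n G x \<le> eucl_dist n x m"
      by (rule bdry_dist_le) fact
    show "eucl_dist n x m \<le> bdry_dist n G x"
      unfolding bdry_dist_def using z le by (intro cINF_greatest) auto
  qed
  ultimately show ?thesis
    using that by simp
qed

lemma bdry_dist_pos:
  assumes "x \<in> G"
  shows "0 < bdry_dist n G x"
proof -
  obtain m where m: "m \<in> bdry n G" "eucl_dist n x m = bdry_dist n G x"
    using nearest_bdry_point assms .
  then have "eucl_dist n x m \<noteq> 0"
    using eucl_dist_eq_0 assms in_space bdry_in_space bdry_notin by metis
  then show ?thesis
    using m eucl_dist_nonneg[of n x m] by linarith
qed

text \<open>The segment from \<open>x\<close> to \<open>v\<close> crosses the boundary no farther
  away than \<open>v\<close>. Later estimates can therefore range over all points outside
  \<open>G\<close>.\<close>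

lemma bdry_dist_le_outside:
  assumes x: "x \<in> G" and v: "v \<in> topspace (Euclidean_space n)" "v \<notin> G"
  shows "bdry_dist n G x \<le> eucl_dist n x v"
proof -
  obtain u where u: "0 \<le> u" "u \<le> 1" "lerp x v u \<in> bdry n G"
    using segment_meets_bdry[OF in_space[OF x] v(1) x v(2)] .
  then have "bdry_dist n G x \<le> \<bar>u\<bar> * eucl_dist n x v"
    using bdry_dist_le eucl_dist_lerp_left by metis
  also have "\<dots> \<le> 1 * eucl_dist n x v"
    using u by (intro mult_right_mono) auto
  finally show ?thesis
    by simp
qed

lemma ball_in:
  assumes "x \<in> G" "y \<in> topspace (Euclidean_space n)" "eucl_dist n x y < bdry_dist n G x"
  shows "y \<in> G"
  using bdry_dist_le_outside assms by force

text \<open>The reflection \<open>lerp x m 2\<close> of \<open>x\<close> in a nearest boundary point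
  \<open>m\<close> is a member. Hence the infima in \<open>w_denom\<close> are never taken over the
  empty set.\<close>

lemma tilde_set_nonempty:
  assumes "x \<in> G"
  shows "tilde_set n G x \<noteq> {}"
proof -
  obtain m where m: "m \<in> bdry n G" "eucl_dist n x m = bdry_dist n G x"
    using nearest_bdry_point assms .
  have "eucl_dist n x (lerp x m 2) = 2 * bdry_dist n G x"
    using eucl_dist_lerp_left[of n x 2 m] m by simp
  moreover have "(\<lambda>i. (x i + lerp x m 2 i) / 2) = m"
    by (simp add: field_simps)
  moreover have "lerp x m 2 \<in> topspace (Euclidean_space n)"
    using lerp_in_Euclidean_space in_space assms bdry_in_space m by blast
  ultimately have "lerp x m 2 \<in> tilde_set n G x"
    using m by (simp add: tilde_set_def eucl_sphere_def)
  then show ?thesis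
    by blast
qed

text \<open>The convex hull of the balls around \<open>x\<close> and \<open>y\<close> with radii \<open>bdry_dist n G\<close> lies in \<open>G\<close>.
  The foot \<open>c\<close> of the bisector of the angle \<open>x v y\<close> is the right point of \<open>[x, y]\<close> to compare \<open>v\<close> with.\<close>

lemma outside_sum_sq_ge:
  assumes x: "x \<in> G" and y: "y \<in> G" and v: "v \<in> topspace (Euclidean_space n)" "v \<notin> G"
  shows "(eucl_dist n x y)\<^sup>2 + 4 * bdry_dist n G x * bdry_dist n G y
    \<le> (eucl_dist n x v + eucl_dist n v y)\<^sup>2"
proof (rule ccontr)
  define a b D P Q where "a = bdry_dist n G x" and "b = bdry_dist n G y" and "D = eucl_dist n x y"
    and "P = eucl_dist n v x" and "Q = eucl_dist n v y"
  note defs = a_def b_def D_def P_def Q_def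
  assume "\<not> ?thesis"
  then have less: "(P + Q)\<^sup>2 < D\<^sup>2 + 4 * a * b"
    by (simp add: defs eucl_dist_commute)
  have a: "0 < a" and b: "0 < b"
    using bdry_dist_pos x y by (auto simp: defs)
  have P: "0 < P" and Q: "0 < Q"
    using bdry_dist_le_outside[OF x v] bdry_dist_le_outside[OF y v] a b
    by (simp_all add: defs eucl_dist_commute)
  define t where "t = P / (P + Q)"
  have t: "0 < t" "t < 1" and t': "1 - t = Q / (P + Q)"
    using P Q by (auto simp: t_def field_simps)
  \<comment> \<open>\<open>\<rho>\<close> is the radius of the ball about \<open>c\<close> obtained
    by interpolating the balls about \<open>x\<close> and \<open>y\<close>. The contradiction will
    be that \<open>v\<close> lies in this ball.\<close>
  define c \<rho> where "c = lerp x y t" and "\<rho> = (1 - t) * a + t * b"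
  have \<rho>: "0 < \<rho>"
    using t a b by (simp add: \<rho>_def add_pos_pos)
  have "(eucl_dist n v c)\<^sup>2 = (1 - t) * P\<^sup>2 + t * Q\<^sup>2 - t * (1 - t) * D\<^sup>2"
    by (simp add: c_def eucl_dist_lerp_sq defs)
  also have "\<dots> = t * (1 - t) * ((P + Q)\<^sup>2 - D\<^sup>2)"
  proof -
    have "(1 - t) * P\<^sup>2 + t * Q\<^sup>2 = P * Q"
      using P Q unfolding t' t_def by (simp add: divide_simps) (simp add: power2_eq_square algebra_simps)
    moreover have "t * (1 - t) * (P + Q)\<^sup>2 = P * Q"
      using P Q unfolding t' t_def by (simp add: divide_simps power2_eq_square)
    ultimately show ?thesis
      by (simp add: right_diff_distrib)
  qed
  also have "\<dots> < t * (1 - t) * (4 * a * b)"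
    using less t by (intro mult_strict_left_mono) auto
  \<comment> \<open>The inequality of arithmetic and geometric means for \<open>(1 - t) * a\<close>
    and \<open>t * b\<close>.\<close>
  also have "\<dots> \<le> \<rho>\<^sup>2"
  proof -
    have "\<rho>\<^sup>2 - t * (1 - t) * (4 * a * b) = ((1 - t) * a - t * b)\<^sup>2"
      unfolding \<rho>_def by (simp add: power2_eq_square algebra_simps)
    then show ?thesis
      using zero_le_power2[of "(1 - t) * a - t * b"] by linarith
  qed
  finally have c: "eucl_dist n v c < \<rho>"
    using \<rho> by (simp add: power_less_imp_less_base)
  have "c \<in> topspace (Euclidean_space n)"
    unfolding c_def by (intro lerp_in_Euclidean_space in_space x y)
  \<comment> \<open>Each endpoint moves in the direction \<open>v - c\<close>, in proportion to its
    own radius, and stays inside its ball because \<open>v\<close> is closer to \<open>c\<close>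
    than \<open>\<rho>\<close>. Interpolating the moved endpoints with the same \<open>t\<close>
    gives back \<open>v\<close>.\<close>
  have shift: "(\<lambda>i. z i + bdry_dist n G z / \<rho> * (v i - c i)) \<in> G" if z: "z \<in> G" for z
  proof (rule ball_in[OF z])
    show "(\<lambda>i. z i + bdry_dist n G z / \<rho> * (v i - c i)) \<in> topspace (Euclidean_space n)"
      using in_space[OF z] v \<open>c \<in> _\<close> by (simp add: topspace_Euclidean_space)
    have "eucl_dist n z (\<lambda>i. z i + bdry_dist n G z / \<rho> * (v i - c i)) =
        \<bar>- (bdry_dist n G z / \<rho>)\<bar> * eucl_dist n v c"
      by (rule eucl_dist_scaled) simp
    also have "\<dots> < bdry_dist n G z"
      using bdry_dist_pos[OF z] \<rho> c by (simp add: field_simps)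
    finally show "eucl_dist n z (\<lambda>i. z i + bdry_dist n G z / \<rho> * (v i - c i)) < bdry_dist n G z" .
  qed
  have "v = lerp (\<lambda>i. x i + a / \<rho> * (v i - c i)) (\<lambda>i. y i + b / \<rho> * (v i - c i)) t"
  proof
    fix i
    have "(1 - t) * (x i + a / \<rho> * (v i - c i)) + t * (y i + b / \<rho> * (v i - c i)) =
        c i + ((1 - t) * a + t * b) / \<rho> * (v i - c i)"
      by (simp add: c_def algebra_simps add_divide_distrib diff_divide_distrib)
    also have "\<dots> = v i"
      using \<rho> by (simp flip: \<rho>_def)
    finally show "v i = (1 - t) * (x i + a / \<rho> * (v i - c i)) + t * (y i + b / \<rho> * (v i - c i))" ..
  qed
  also have "\<dots> \<in> G"
    using t shift[OF x] shift[OF y] by (intro lerp_in) (auto simp: defs)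
  finally show False
    using v by simp
qed

section \<open>The denominator compared with detours through outside points\<close>

lemma w_denom_le_outside:
  assumes x: "x \<in> G" and y: "y \<in> G" and v: "v \<in> topspace (Euclidean_space n)" "v \<notin> G"
  shows "w_denom n G x y \<le> sqrt 2 * (eucl_dist n x v + eucl_dist n v y)"
proof -
  \<comment> \<open>The tilde point is taken at the endpoint with the smaller boundary distance, so
    that \<open>4 * a * a\<close> can be enlarged to the product of both distances in
    \<open>outside_sum_sq_ge\<close>.\<close>
  have *: "w_denom n G y x \<le> sqrt 2 * (eucl_dist n x v + eucl_dist n v y)"
    if x: "x \<in> G" and y: "y \<in> G" and le: "bdry_dist n G x \<le> bdry_dist n G y" for x y
  proof -
    let ?D = "eucl_dist n x y" and ?a = "bdry_dist n G x"
    obtain x' where x': "x' \<in> tilde_set n G x"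
      using tilde_set_nonempty x by blast
    have "w_denom n G y x \<le> eucl_dist n y x'"
      by (rule w_denom_le) fact
    also have "\<dots> \<le> eucl_dist n y x + eucl_dist n x x'"
      by (rule eucl_dist_triangle)
    also have "\<dots> = ?D + 2 * ?a"
      using tilde_setD(2)[OF x'] by (simp add: eucl_dist_commute)
    also have "\<dots> \<le> sqrt (2 * (?D\<^sup>2 + 4 * ?a * bdry_dist n G y))"
    proof (rule real_le_rsqrt)
      have "(?D + 2 * ?a)\<^sup>2 \<le> 2 * (?D\<^sup>2 + 4 * ?a * ?a)"
        using zero_le_power2[of "?D - 2 * ?a"] by (simp add: power2_eq_square algebra_simps)
      also have "\<dots> \<le> 2 * (?D\<^sup>2 + 4 * ?a * bdry_dist n G y)"
        using le bdry_dist_pos[OF x] by simp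
      finally show "(?D + 2 * ?a)\<^sup>2 \<le> 2 * (?D\<^sup>2 + 4 * ?a * bdry_dist n G y)" .
    qed
    also have "\<dots> \<le> sqrt (2 * (eucl_dist n x v + eucl_dist n v y)\<^sup>2)"
      using outside_sum_sq_ge[OF x y v] by simp
    also have "\<dots> = sqrt 2 * (eucl_dist n x v + eucl_dist n v y)"
      by (simp add: real_sqrt_mult)
    finally show ?thesis .
  qed
  show ?thesis
  proof (cases "bdry_dist n G x \<le> bdry_dist n G y")
    case True
    then show ?thesis
      using *[OF x y] by (simp add: w_denom_commute)
  next
    case False
    then show ?thesis
      using *[OF y x] by (simp add: eucl_dist_commute add.commute)
  qed
qed

text \<open>\<open>G\<close> lies in the open half-space bounded by the perpendicular bisector of \<open>[y, y']\<close>: from a point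
  \<open>g\<close> of \<open>G\<close> beyond it, the ray through the midpoint \<open>m\<close> enters the ball around \<open>y\<close>
  just after \<open>m\<close>, which puts \<open>m\<close> inside \<open>G\<close>. Moving \<open>g\<close> towards \<open>y'\<close> first
  covers the points on the bisector itself.\<close>

lemma closer_than_tilde:
  assumes y: "y \<in> G" and y': "y' \<in> tilde_set n G y" and g: "g \<in> G"
  shows "eucl_dist n g y < eucl_dist n g y'"
proof (rule ccontr)
  assume "\<not> ?thesis"
  then have far: "eucl_dist n g y' \<le> eucl_dist n g y"
    by simp
  note y'D = tilde_setD[OF y']
  define b m where "b = bdry_dist n G y" and "m = lerp y y' (1/2)"
  have b: "0 < b" and yy': "eucl_dist n y y' = 2 * b"
    using bdry_dist_pos y y'D by (auto simp: b_def)
  have m: "m \<notin> G" "m \<in> topspace (Euclidean_space n)"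
    using y'D bdry_notin bdry_in_space by (auto simp: m_def)
  obtain \<delta> where \<delta>: "0 < \<delta>" "\<delta> \<le> 1" "\<delta> * eucl_dist n g y' < bdry_dist n G g"
    using exists_small_factor[OF bdry_dist_pos[OF g] eucl_dist_nonneg] .
  define h where "h = lerp g y' \<delta>"
  have h: "h \<in> G"
    unfolding h_def using \<delta> g y'D in_space
    by (intro ball_in[OF g] lerp_in_Euclidean_space) (auto simp: eucl_dist_lerp_left)
  define P Q M where "P = eucl_dist n y h" and "Q = eucl_dist n y' h" and "M = eucl_dist n h m"
  have "P\<^sup>2 - Q\<^sup>2 = (1 - \<delta>) * ((eucl_dist n g y)\<^sup>2 - (eucl_dist n g y')\<^sup>2) + \<delta> * (2 * b)\<^sup>2"
    unfolding P_def Q_def h_def eucl_dist_lerp_sq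
    using yy' by (simp add: eucl_dist_commute algebra_simps)
  moreover have "0 \<le> (1 - \<delta>) * ((eucl_dist n g y)\<^sup>2 - (eucl_dist n g y')\<^sup>2)"
    using \<delta> far by (intro mult_nonneg_nonneg) (auto intro: power_mono)
  moreover have "0 < \<delta> * (2 * b)\<^sup>2"
    using \<delta> b by simp
  ultimately have PQ: "0 < (P\<^sup>2 - Q\<^sup>2) / 2"
    by simp
  have M: "M\<^sup>2 = P\<^sup>2 / 2 + Q\<^sup>2 / 2 - b\<^sup>2"
    unfolding M_def m_def eucl_dist_lerp_sq
    using yy' by (simp add: P_def Q_def eucl_dist_commute power_mult_distrib)
  \<comment> \<open>For the point \<open>k\<close> below, Stewart's theorem gives squared distance
    \<open>b\<^sup>2 + \<epsilon> * (\<epsilon> * M\<^sup>2 - (P\<^sup>2 - Q\<^sup>2) / 2)\<close>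
    to \<open>y\<close>; this choice makes the bracket negative.\<close>
  obtain \<epsilon> where \<epsilon>: "0 < \<epsilon>" "\<epsilon> \<le> 1" "\<epsilon> * M\<^sup>2 < (P\<^sup>2 - Q\<^sup>2) / 2"
    using exists_small_factor[OF PQ zero_le_power2] .
  define k where "k = lerp h m (1 + \<epsilon>)"
  have ym: "eucl_dist n y m = b"
    unfolding m_def eucl_dist_lerp_left yy' by simp
  have "(eucl_dist n y k)\<^sup>2 = - \<epsilon> * P\<^sup>2 + (1 + \<epsilon>) * b\<^sup>2 + (1 + \<epsilon>) * \<epsilon> * M\<^sup>2"
    unfolding k_def eucl_dist_lerp_sq by (simp add: ym flip: P_def M_def)
  also have "\<dots> = b\<^sup>2 + \<epsilon> * (\<epsilon> * M\<^sup>2 - (P\<^sup>2 - Q\<^sup>2) / 2)"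
    unfolding M by (simp add: field_simps)
  also have "\<dots> < b\<^sup>2"
    using \<epsilon> by (simp add: mult_pos_neg)
  finally have "eucl_dist n y k < b"
    using b by (simp add: power_less_imp_less_base)
  then have "k \<in> G"
    unfolding k_def using h m in_space y
    by (intro ball_in[OF y] lerp_in_Euclidean_space) (auto simp: b_def)
  then have "lerp h k (1 / (1 + \<epsilon>)) \<in> G"
    using h \<epsilon> by (intro lerp_in) auto
  moreover have "lerp h k (1 / (1 + \<epsilon>)) = m"
  proof
    fix i
    have "lerp h k (1 / (1 + \<epsilon>)) i = h i + 1 / (1 + \<epsilon>) * (k i - h i)"
      by (simp add: left_diff_distrib right_diff_distrib)
    also have "k i - h i = (1 + \<epsilon>) * (m i - h i)"
      by (simp add: k_def algebra_simps)
    finally show "lerp h k (1 / (1 + \<epsilon>)) i = m i"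
      using \<epsilon> by simp
  qed
  ultimately show False
    using m by simp
qed

text \<open>\<open>v\<close> is where the segment from \<open>x\<close> to \<open>y'\<close> meets
  the perpendicular bisector of \<open>y\<close> and \<open>y'\<close>, found by the intermediate
  value theorem. Being equidistant from \<open>y\<close> and \<open>y'\<close>, it lies outside
  \<open>G\<close> by \<open>closer_than_tilde\<close>, and the detour to \<open>y\<close> is as
  long as the straight way to \<open>y'\<close>.\<close>

lemma outside_point_le_tilde:
  assumes x: "x \<in> G" and y: "y \<in> G" and y': "y' \<in> tilde_set n G y"
  obtains v where "v \<in> topspace (Euclidean_space n)" "v \<notin> G"
    "eucl_dist n x v + eucl_dist n v y = eucl_dist n x y'"
proof -
  note y'D = tilde_setD[OF y']
  define f where "f u = eucl_dist n y (lerp x y' u) - eucl_dist n y' (lerp x y' u)" for u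
  have "f 0 \<le> 0"
    using closer_than_tilde[OF y y' x] by (simp add: f_def eucl_dist_commute)
  moreover have "0 \<le> f 1"
    by (simp add: f_def)
  moreover have "continuous_on {0..1} f"
    unfolding f_def
    by (intro continuous_on_diff continuous_on_compose2[OF continuous_on_eucl_dist[of UNIV]]
        continuous_intros) auto
  ultimately obtain u where u: "0 \<le> u" "u \<le> 1" "f u = 0"
    using IVT'[of f 0 0 1] by auto
  let ?v = "lerp x y' u"
  have "?v \<in> topspace (Euclidean_space n)"
    using x y'D in_space by (intro lerp_in_Euclidean_space)
  moreover have eq: "eucl_dist n ?v y = eucl_dist n ?v y'"
    using u eucl_dist_commute[of n ?v] by (simp add: f_def)
  then have "?v \<notin> G"
    using closer_than_tilde[OF y y', of ?v] by auto
  moreover have "eucl_dist n x ?v + eucl_dist n ?v y = eucl_dist n x y'"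
    unfolding eq eucl_dist_lerp_left eucl_dist_lerp_right using u by (simp add: algebra_simps)
  ultimately show ?thesis
    using that by blast
qed

text \<open>This is \<open>w \<le> s\<close> without forming the supremum: every distance in
  \<open>w_denom\<close> equals the length of some detour through an outside point.\<close>

lemma w_denom_ge:
  assumes "x \<in> G" "y \<in> G"
    and "\<And>v. v \<in> topspace (Euclidean_space n) \<Longrightarrow> v \<notin> G \<Longrightarrow> K \<le> eucl_dist n x v + eucl_dist n v y"
  shows "K \<le> w_denom n G x y"
proof -
  have "K \<le> eucl_dist n x y'" if "y' \<in> tilde_set n G y" for y'
    using outside_point_le_tilde[OF assms(1,2) that] assms(3) by metis
  moreover have "K \<le> eucl_dist n y x'" if "x' \<in> tilde_set n G x" for x'
    using outside_point_le_tilde[OF assms(2,1) that] assms(3) by (metis add.commute eucl_dist_commute)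
  ultimately show ?thesis
    unfolding w_denom_def using tilde_set_nonempty assms
    by (intro min.boundedI cINF_greatest) auto
qed

lemma w_denom_ge_bdry_dist:
  assumes "x \<in> G" "y \<in> G"
  shows "bdry_dist n G x \<le> w_denom n G x y"
proof (rule w_denom_ge[OF assms])
  fix v assume "v \<in> topspace (Euclidean_space n)" "v \<notin> G"
  then show "bdry_dist n G x \<le> eucl_dist n x v + eucl_dist n v y"
    using bdry_dist_le_outside[OF assms(1), of v] eucl_dist_nonneg[of n v y] by linarith
qed

section \<open>The quasi-metric properties of \<open>w_fun\<close>\<close>

lemma w_denom_pos: "x \<in> G \<Longrightarrow> y \<in> G \<Longrightarrow> 0 < w_denom n G x y"
  using w_denom_ge_bdry_dist bdry_dist_pos by fastforce

lemma w_fun_nonneg: "x \<in> G \<Longrightarrow> y \<in> G \<Longrightarrow> 0 \<le> w_fun n G x y"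
  using w_denom_pos[of x y] by (simp add: w_fun_eq)

text \<open>For each \<open>v\<close> outside \<open>G\<close> the ratio at \<open>v\<close> obeys
  the triangle inequality and is at most \<open>sqrt 2 * w_fun\<close>. The resulting bound is
  uniform in \<open>v\<close>, so \<open>w_denom_ge\<close> turns it into one on
  \<open>w_fun\<close>.\<close>

lemma w_fun_triangle:
  assumes x: "x \<in> G" and y: "y \<in> G" and z: "z \<in> G"
  shows "w_fun n G x y \<le> sqrt 2 * (w_fun n G x z + w_fun n G z y)"
proof (cases "x = y")
  case True
  then show ?thesis
    using w_fun_nonneg assms by (simp add: w_fun_eq)
next
  case False
  let ?K = "sqrt 2 * (w_fun n G x z + w_fun n G z y)"
  have ratio: "eucl_dist n p q / (eucl_dist n p v + eucl_dist n v q) \<le> sqrt 2 * w_fun n G p q"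
    if p: "p \<in> G" and q: "q \<in> G" and v: "v \<in> topspace (Euclidean_space n)" "v \<notin> G" for p q v
  proof -
    have "eucl_dist n p q / (eucl_dist n p v + eucl_dist n v q) =
        sqrt 2 * eucl_dist n p q / (sqrt 2 * (eucl_dist n p v + eucl_dist n v q))"
      by simp
    also have "\<dots> \<le> sqrt 2 * eucl_dist n p q / w_denom n G p q"
    proof (rule divide_left_mono)
      show "w_denom n G p q \<le> sqrt 2 * (eucl_dist n p v + eucl_dist n v q)"
        by (rule w_denom_le_outside[OF that])
      then have "0 < sqrt 2 * (eucl_dist n p v + eucl_dist n v q)"
        using w_denom_pos[OF p q] by linarith
      then show "0 < sqrt 2 * (eucl_dist n p v + eucl_dist n v q) * w_denom n G p q"
        using w_denom_pos[OF p q] by (rule mult_pos_pos)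
    qed simp
    finally show ?thesis
      by (simp add: w_fun_eq)
  qed
  have ineq: "eucl_dist n x y \<le> ?K * (eucl_dist n x v + eucl_dist n v y)"
    if v: "v \<in> topspace (Euclidean_space n)" "v \<notin> G" for v
  proof -
    have pos: "0 < eucl_dist n p v" if "p \<in> G" for p
      using bdry_dist_le_outside[OF that v] bdry_dist_pos[OF that] by linarith
    have "eucl_dist n x y / (eucl_dist n x v + eucl_dist n v y) \<le> ?K"
      using ratio_triangle[OF pos[OF x] pos[OF y] pos[OF z]] ratio[OF x z v] ratio[OF z y v]
      by (simp add: distrib_left)
    moreover have "0 < eucl_dist n x v + eucl_dist n v y"
      using pos[OF x] by (simp add: add_pos_nonneg)
    ultimately show ?thesis
      by (simp add: pos_divide_le_eq)
  qed
  \<comment> \<open>Dividing by \<open>?K\<close> needs \<open>0 < ?K\<close>, which follows from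
    \<open>ineq\<close> at a single outside point \<open>e\<close>. For \<open>x = y = z\<close> it
    would fail, hence the case split.\<close>
  have "0 < eucl_dist n x y"
    using False eucl_dist_eq_0[OF in_space[OF x] in_space[OF y]] by (simp add: less_le)
  moreover obtain e where "e \<in> topspace (Euclidean_space n)" "e \<notin> G"
    using proper_convex_domain by (auto simp: proper_convex_domain_def)
  ultimately have "0 < ?K * (eucl_dist n x e + eucl_dist n e y)"
    using ineq[of e] by linarith
  then have K: "0 < ?K"
    using eucl_dist_nonneg[of n x e] eucl_dist_nonneg[of n e y]
    by (smt (verit) zero_less_mult_iff)
  have "eucl_dist n x y / ?K \<le> w_denom n G x y"
  proof (rule w_denom_ge[OF x y])
    fix v assume "v \<in> topspace (Euclidean_space n)" "v \<notin> G"
    then show "eucl_dist n x y / ?K \<le> eucl_dist n x v + eucl_dist n v y"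
      using ineq K by (simp add: pos_divide_le_eq mult.commute)
  qed
  then show ?thesis
    using K w_denom_pos[OF x y] by (simp add: w_fun_eq pos_divide_le_eq mult.commute)
qed

lemma quasi_metric: "quasi_metric_on G (w_fun n G) (sqrt 2)"
  unfolding quasi_metric_on_def
proof (intro conjI ballI)
  fix x y assume "x \<in> G" "y \<in> G"
  then show "w_fun n G x y = 0 \<longleftrightarrow> x = y"
    using w_denom_pos[of x y] eucl_dist_eq_0[of x n y] in_space by (simp add: w_fun_eq)
  show "w_fun n G x y = w_fun n G y x"
    by (simp add: w_fun_eq w_denom_commute eucl_dist_commute)
qed (auto intro: w_fun_nonneg w_fun_triangle)

lemma bdry_dist_eqI:
  assumes "x \<in> G" "m \<in> topspace (Euclidean_space n)" "m \<notin> G" "eucl_dist n x m = r"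
    and "\<And>v. v \<in> topspace (Euclidean_space n) \<Longrightarrow> v \<notin> G \<Longrightarrow> r \<le> eucl_dist n x v"
  shows "bdry_dist n G x = r"
  using assms nearest_bdry_point bdry_notin bdry_in_space bdry_dist_le_outside by (metis antisym)

text \<open>A crossing of the segment from \<open>x\<close> to \<open>m\<close> before
  \<open>m\<close> would be closer than the boundary distance. Boundary membership can thus be
  checked by distances alone.\<close>

lemma nearest_outside_in_bdry:
  assumes x: "x \<in> G" and m: "m \<in> topspace (Euclidean_space n)" "m \<notin> G"
    and eq: "eucl_dist n x m = bdry_dist n G x"
  shows "m \<in> bdry n G"
proof -
  obtain u where u: "0 \<le> u" "u \<le> 1" "lerp x m u \<in> bdry n G"
    using segment_meets_bdry[OF in_space[OF x] m(1) x m(2)] .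
  then have "bdry_dist n G x \<le> u * bdry_dist n G x"
    using bdry_dist_le[OF u(3), of x] by (simp add: eucl_dist_lerp_left eq)
  then have "u = 1"
    using u bdry_dist_pos[OF x] by simp
  then show ?thesis
    using u by simp
qed

end

section \<open>Sharpness: the half-strip in the plane\<close>

lemma eucl_dist_2: "eucl_dist 2 x y = sqrt ((x 0 - y 0)\<^sup>2 + (x 1 - y 1)\<^sup>2)"
  by (simp add: eucl_dist_def L2_set_def numeral_2_eq_2)

definition point2 :: "real \<Rightarrow> real \<Rightarrow> nat \<Rightarrow> real" where
  "point2 a b = (\<lambda>i. if i = 0 then a else if i = 1 then b else 0)"

lemma point2_simps [simp]: "point2 a b 0 = a" "point2 a b 1 = b" "point2 a b (Suc 0) = b"
  by (simp_all add: point2_def)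

lemma point2_in_space [simp]: "point2 a b \<in> topspace (Euclidean_space 2)"
  by (auto simp: point2_def topspace_Euclidean_space)

definition half_strip :: "(nat \<Rightarrow> real) set" where
  "half_strip = {x \<in> topspace (Euclidean_space 2). \<bar>x 0\<bar> < 2 \<and> x 1 < 1}"

lemma seq_convex_half_strip: "seq_convex half_strip"
  unfolding seq_convex_def
proof (intro ballI)
  fix x y u assume x: "x \<in> half_strip" and y: "y \<in> half_strip" and "u \<in> {0..1::real}"
  then have u: "0 \<le> u" "u \<le> 1"
    by auto
  have comb: "lerp x y u i < K" if "x i < K" "y i < K" for i K
    using convex_bound_lt[OF that, of "1 - u" u] u by simp
  have comb': "- K < lerp x y u i" if "- K < x i" "- K < y i" for i K
    using convex_bound_lt[of "- x i" K "- y i" "1 - u" u] that u by simp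
  show "lerp x y u \<in> half_strip"
    using x y comb[of 0 2] comb[of 1 1] comb'[of 2 0]
    by (simp add: half_strip_def abs_less_iff lerp_in_Euclidean_space)
qed

lemma proper_convex_domain_half_strip: "proper_convex_domain 2 half_strip"
proof -
  have "point2 0 0 \<in> half_strip" "point2 2 0 \<in> topspace (Euclidean_space 2) - half_strip"
    by (auto simp: half_strip_def)
  moreover have "half_strip \<subseteq> topspace (Euclidean_space 2)"
    by (auto simp: half_strip_def)
  moreover have "openin (Euclidean_space 2) half_strip"
  proof -
    have "open {x :: nat \<Rightarrow> real. \<bar>x 0\<bar> < 2 \<and> x 1 < 1}"
      by (intro open_Collect_conj open_Collect_less continuous_intros) auto
    then have "openin (Euclidean_space 2)
        (topspace (Euclidean_space 2) \<inter> {x. \<bar>x 0\<bar> < 2 \<and> x 1 < 1})"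
      by (rule openin_Euclidean_space_Int_open)
    then show ?thesis
      by (simp only: half_strip_def Int_def mem_Collect_eq)
  qed
  moreover have "connectedin (Euclidean_space 2) half_strip"
  proof -
    have "connected half_strip"
      unfolding connected_iff_connected_component
    proof (intro ballI)
      fix x y assume "x \<in> half_strip" "y \<in> half_strip"
      then have "lerp x y ` {0..1} \<subseteq> half_strip"
        using seq_convex_half_strip by (auto simp: seq_convex_def)
      moreover have "x \<in> lerp x y ` {0..1}" "y \<in> lerp x y ` {0..1}"
        by (auto intro: image_eqI[of _ _ 0] image_eqI[of _ _ 1])
      ultimately show "connected_component half_strip x y"
        using connected_lerp by (auto simp: connected_component_def)
    qed
    then show ?thesis
      by (subst Euclidean_space_eq_top_of_set) (auto simp: connectedin_subtopology half_strip_def)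
  qed
  ultimately show ?thesis
    using seq_convex_half_strip unfolding proper_convex_domain_def domain_in_def by blast
qed

interpretation half_strip: convex_domain 2 half_strip
  by standard (rule proper_convex_domain_half_strip)

lemma outside_half_stripD:
  assumes "v \<in> topspace (Euclidean_space 2)" "v \<notin> half_strip"
  shows "2 \<le> \<bar>v 0\<bar> \<or> 1 \<le> v 1"
  using assms by (auto simp: half_strip_def)

context
  fixes s \<epsilon> :: real
  assumes s: "\<bar>s\<bar> = 1" and \<epsilon>: "0 \<le> \<epsilon>" "\<epsilon> < 1"
begin

lemma half_strip_axis_point: "point2 (s * (1 + \<epsilon>)) 0 \<in> half_strip"
  using s \<epsilon> by (simp add: half_strip_def abs_mult)

lemma bdry_dist_half_strip: "bdry_dist 2 half_strip (point2 (s * (1 + \<epsilon>)) 0) = 1 - \<epsilon>"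
proof (rule half_strip.bdry_dist_eqI[OF half_strip_axis_point, of "point2 (2 * s) 0"])
  show "point2 (2 * s) 0 \<notin> half_strip"
    using s by (simp add: half_strip_def abs_mult)
  have "eucl_dist 2 (point2 (s * (1 + \<epsilon>)) 0) (point2 (2 * s) 0) = \<bar>s * (1 + \<epsilon>) - 2 * s\<bar>"
    by (simp add: eucl_dist_2)
  also have "\<dots> = 1 - \<epsilon>"
    using s \<epsilon> by (auto simp: abs_if split: if_splits)
  finally show "eucl_dist 2 (point2 (s * (1 + \<epsilon>)) 0) (point2 (2 * s) 0) = 1 - \<epsilon>" .
next
  fix v assume v: "v \<in> topspace (Euclidean_space 2)" "v \<notin> half_strip"
  have "\<bar>s * (1 + \<epsilon>)\<bar> = 1 + \<epsilon>"
    using s \<epsilon> by (simp add: abs_mult)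
  then show "1 - \<epsilon> \<le> eucl_dist 2 (point2 (s * (1 + \<epsilon>)) 0) v"
    using outside_half_stripD[OF v] \<epsilon> coord_le_eucl_dist[of 0 2 "point2 (s * (1 + \<epsilon>)) 0" v]
      coord_le_eucl_dist[of 1 2 "point2 (s * (1 + \<epsilon>)) 0" v] by auto
qed simp

text \<open>For \<open>0 < \<epsilon>\<close> the top edge is too far away, so the midpoint lies on
  or beyond the side wall, and reflecting in it gives at least
  \<open>2 * 2 - (1 + \<epsilon>)\<close>.\<close>

lemma tilde_set_half_strip:
  assumes "0 < \<epsilon>" and x': "x' \<in> tilde_set 2 half_strip (point2 (s * (1 + \<epsilon>)) 0)"
  shows "3 - \<epsilon> \<le> s * x' 0"
proof -
  let ?x = "point2 (s * (1 + \<epsilon>)) 0"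
  define m where "m = lerp ?x x' (1/2)"
  note x'D = tilde_setD[OF x']
  have m: "m \<in> topspace (Euclidean_space 2)" "m \<notin> half_strip"
    using x'D half_strip.bdry_in_space half_strip.bdry_notin by (auto simp: m_def)
  have "eucl_dist 2 ?x m = 1 - \<epsilon>"
    unfolding m_def eucl_dist_lerp_left x'D(2) bdry_dist_half_strip by simp
  then have "\<bar>s * (1 + \<epsilon>) - m 0\<bar> \<le> 1 - \<epsilon>" "\<bar>m 1\<bar> \<le> 1 - \<epsilon>"
    using coord_le_eucl_dist[of 0 2 ?x m] coord_le_eucl_dist[of 1 2 ?x m] by auto
  moreover have "m 0 = (s * (1 + \<epsilon>) + x' 0) / 2"
    by (simp add: m_def)
  ultimately show ?thesis
    using outside_half_stripD[OF m] s assms(1) by (auto simp: abs_if split: if_splits)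
qed

end

lemma sqrt2_sharp:
  assumes "c < sqrt 2"
  obtains x y z where "x \<in> half_strip" "y \<in> half_strip" "z \<in> half_strip"
    "w_fun 2 half_strip x y > c * (w_fun 2 half_strip x z + w_fun 2 half_strip z y)"
proof -
  \<comment> \<open>A negative \<open>c\<close> would reverse the upper bounds on
    \<open>w_fun\<close> when multiplied by them.\<close>
  define C where "C = max c 0"
  have C: "0 \<le> C" "c \<le> C" "C < sqrt 2"
    using assms by (auto simp: C_def)
  \<comment> \<open>The lower bound \<open>xy\<close> minus \<open>C\<close> times the sum of the
    upper bounds \<open>xz\<close> and \<open>zy\<close> below. Its value at 0 is
    \<open>(sqrt 2 - C) / 2\<close>, so it stays positive for small
    \<open>\<epsilon>\<close>.\<close>
  define f where "f \<epsilon> = (2 + \<epsilon>) / sqrt ((2 + \<epsilon>)\<^sup>2 + 4) - C * ((2 + 2 * \<epsilon>) / 4 + 2 * \<epsilon>)" for \<epsilon> :: real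
  have "(f \<longlongrightarrow> f 0) (at_right 0)"
    unfolding f_def by (auto intro!: tendsto_eq_intros)
  moreover have "0 < f 0"
  proof -
    have "sqrt 8 = 2 * sqrt 2"
      using real_sqrt_mult[of 4 2] by simp
    then have "f 0 = (sqrt 2 - C) / 2"
      by (simp add: f_def field_simps)
    then show ?thesis
      using C by simp
  qed
  ultimately have "\<forall>\<^sub>F \<epsilon> in at_right 0. 0 < f \<epsilon>"
    by (rule order_tendstoD)
  moreover have "\<forall>\<^sub>F \<epsilon> in at_right 0. \<epsilon> \<in> {0<..<1/2 :: real}"
    by (rule eventually_at_right_real) simp
  ultimately have "\<forall>\<^sub>F \<epsilon> in at_right 0. 0 < f \<epsilon> \<and> \<epsilon> \<in> {0<..<1/2 :: real}"
    by (rule eventually_conj)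
  then obtain \<epsilon> where \<epsilon>: "0 < f \<epsilon>" "0 < \<epsilon>" "\<epsilon> < 1/2"
    using eventually_happens[of _ "at_right (0::real)"] by auto
  define x y z where "x = point2 (- 1 * (1 + \<epsilon>)) 0" and "y = point2 (1 * (1 + 0)) 0"
    and "z = point2 (1 * (1 + \<epsilon>)) 0"
  note defs = x_def y_def z_def
  have G: "x \<in> half_strip" "y \<in> half_strip" "z \<in> half_strip"
    unfolding defs by (rule half_strip_axis_point; use \<epsilon> in simp)+
  have d: "bdry_dist 2 half_strip y = 1" "bdry_dist 2 half_strip z = 1 - \<epsilon>"
    unfolding defs using \<epsilon> by (subst bdry_dist_half_strip; simp)+
  have xy: "(2 + \<epsilon>) / sqrt ((2 + \<epsilon>)\<^sup>2 + 4) \<le> w_fun 2 half_strip x y"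
  proof -
    \<comment> \<open>The tilde point \<open>(1, 2)\<close> is the reflection of \<open>y\<close> in
      the point \<open>(1, 1)\<close> of the top edge.\<close>
    have mid: "(\<lambda>i. (y i + point2 1 2 i) / 2) = point2 1 1"
      by (auto simp: y_def point2_def)
    have "point2 1 1 \<in> bdry 2 half_strip"
      by (rule half_strip.nearest_outside_in_bdry[OF G(2)])
        (simp_all add: d, simp_all add: half_strip_def eucl_dist_2 y_def)
    then have "point2 1 2 \<in> tilde_set 2 half_strip y"
      by (simp add: tilde_set_def eucl_sphere_def d mid) (simp add: eucl_dist_2 y_def)
    then have "w_denom 2 half_strip x y \<le> eucl_dist 2 x (point2 1 2)"
      by (rule w_denom_le)
    also have "\<dots> = sqrt ((2 + \<epsilon>)\<^sup>2 + 4)"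
      by (simp add: eucl_dist_2 x_def power2_eq_square algebra_simps)
    finally have "(2 + \<epsilon>) / sqrt ((2 + \<epsilon>)\<^sup>2 + 4) \<le> (2 + \<epsilon>) / w_denom 2 half_strip x y"
      using \<epsilon> half_strip.w_denom_pos[OF G(1,2)]
      by (intro divide_left_mono mult_pos_pos) (auto intro: add_nonneg_pos)
    moreover have "eucl_dist 2 x y = 2 + \<epsilon>"
      using \<epsilon> by (simp add: eucl_dist_2 defs)
    ultimately show ?thesis
      by (simp add: w_fun_eq)
  qed
  have xz: "w_fun 2 half_strip x z \<le> (2 + 2 * \<epsilon>) / 4"
  proof -
    \<comment> \<open>The first coordinates alone differ by at least
      \<open>(1 + \<epsilon>) + (3 - \<epsilon>)\<close>.\<close>
    have "4 \<le> eucl_dist 2 x z'" if "z' \<in> tilde_set 2 half_strip z" for z'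
      using tilde_set_half_strip[of 1 \<epsilon> z'] that \<epsilon> coord_le_eucl_dist[of 0 2 x z'] by (simp add: defs)
    moreover have "4 \<le> eucl_dist 2 z x'" if "x' \<in> tilde_set 2 half_strip x" for x'
      using tilde_set_half_strip[of "-1" \<epsilon> x'] that \<epsilon> coord_le_eucl_dist[of 0 2 z x'] by (simp add: defs)
    ultimately have "4 \<le> w_denom 2 half_strip x z"
      unfolding w_denom_def using half_strip.tilde_set_nonempty G
      by (intro min.boundedI cINF_greatest) auto
    moreover have "eucl_dist 2 x z = 2 + 2 * \<epsilon>"
      using \<epsilon> by (simp add: eucl_dist_2 defs)
    ultimately show ?thesis
      using \<epsilon> unfolding w_fun_eq by (intro frac_le) auto
  qed
  have zy: "w_fun 2 half_strip z y \<le> 2 * \<epsilon>"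
  proof -
    \<comment> \<open>A crude bound from \<open>\<epsilon> < 1/2\<close> suffices, since this term
      only has to vanish with \<open>\<epsilon>\<close>.\<close>
    have "1 / 2 \<le> w_denom 2 half_strip z y"
      using half_strip.w_denom_ge_bdry_dist[OF G(3,2)] d \<epsilon> by linarith
    then have "\<epsilon> / w_denom 2 half_strip z y \<le> \<epsilon> / (1 / 2)"
      using \<epsilon> by (intro divide_left_mono) auto
    moreover have "eucl_dist 2 z y = \<epsilon>"
      using \<epsilon> by (simp add: eucl_dist_2 defs)
    ultimately show ?thesis
      by (simp add: w_fun_eq)
  qed
  have "c * (w_fun 2 half_strip x z + w_fun 2 half_strip z y)
      \<le> C * (w_fun 2 half_strip x z + w_fun 2 half_strip z y)"
    using C half_strip.w_fun_nonneg G by (intro mult_right_mono add_nonneg_nonneg) auto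
  also have "\<dots> \<le> C * ((2 + 2 * \<epsilon>) / 4 + 2 * \<epsilon>)"
    using C xz zy by (intro mult_left_mono add_mono) auto
  also have "\<dots> < (2 + \<epsilon>) / sqrt ((2 + \<epsilon>)\<^sup>2 + 4)"
    using \<epsilon> by (simp add: f_def)
  also note xy
  finally show ?thesis
    using that G by blast
qed

theorem corollary4p8:
  shows "(\<forall>n\<ge>1. \<forall>G. proper_convex_domain n G \<longrightarrow>
            (\<exists>c\<le>sqrt 2. quasi_metric_on G (w_fun n G) c))
       \<and> (\<forall>c<sqrt 2. \<exists>n\<ge>1. \<exists>G. proper_convex_domain n G \<and>
            (\<exists>x\<in>G. \<exists>y\<in>G. \<exists>z\<in>G. w_fun n G x y > c * (w_fun n G x z + w_fun n G z y)))"
proof (intro conjI allI impI)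
  fix n G assume "proper_convex_domain n G"
  then interpret convex_domain n G
    by (rule convex_domain.intro)
  show "\<exists>c\<le>sqrt 2. quasi_metric_on G (w_fun n G) c"
    using quasi_metric by blast
next
  fix c :: real assume "c < sqrt 2"
  then obtain x y z where "x \<in> half_strip" "y \<in> half_strip" "z \<in> half_strip"
    "w_fun 2 half_strip x y > c * (w_fun 2 half_strip x z + w_fun 2 half_strip z y)"
    by (rule sqrt2_sharp)
  then show "\<exists>n\<ge>1. \<exists>G. proper_convex_domain n G \<and>
      (\<exists>x\<in>G. \<exists>y\<in>G. \<exists>z\<in>G. w_fun n G x y > c * (w_fun n G x z + w_fun n G z y))"
    using proper_convex_domain_half_strip by (intro exI[of _ 2] conjI exI[of _ half_strip]) auto
qed

end
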